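(* Let $N\ge1$ and $n\in\mathbb Z$. Then $$\mathcal M_{1;n}=\frac{t^N}{t-1}\sum_{j=0}^N(-t^{-1})^j\,e_j(x_1,\dots,x_N)\,M_{1;n-j},$$ where $e_j$ are the elementary symmetric functions (acting by multiplication).
   Context: $q,t$ are indeterminates; operators act on symmetric rational functions of $x_1,\dots,x_N$ over $\mathbb C(q,t)$; $\Gamma_i$ is the shift $x_i\mapsto qx_i$ (other variables fixed). For $n\in\mathbb Z$, $$\mathcal M_{1;n}=\sum_{i=1}^Nx_i^n\prod_{j\ne i}\frac{tx_i-x_j}{x_i-x_j}\,\Gamma_i,\qquad M_{1;n}=\lim_{t\to\infty}t^{-(N-1)}\mathcal M_{1;n}=\sum_{i=1}^Nx_i^n\prod_{j\ne i}\frac{x_i}{x_i-x_j}\,\Gamma_i .$$ *)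

theory Defs
  imports
    "HOL-Library.Poly_Mapping"
    "HOL-Combinatorics.Permutations"
    "HOL-Computational_Algebra.Polynomial"
    "HOL-Computational_Algebra.Fraction_Field"
begin

section \<open>Polynomials in variables indexed by the naturals\<close>

text \<open>A monomial is a finitely supported exponent function, a polynomial a finitely supported
  coefficient function on monomials; products are convolutions.\<close>

type_synonym 'a mpoly = "(nat \<Rightarrow>\<^sub>0 nat) \<Rightarrow>\<^sub>0 'a"

definition mconst :: "'a::zero \<Rightarrow> 'a mpoly" where
  "mconst c = Poly_Mapping.single 0 c"

definition mvar :: "nat \<Rightarrow> 'a::zero_neq_one mpoly" where
  "mvar k = Poly_Mapping.single (Poly_Mapping.single k 1) 1"

definition mvars :: "'a::zero mpoly \<Rightarrow> nat set" where
  "mvars p = (\<Union>m\<in>Poly_Mapping.keys p. Poly_Mapping.keys m)"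

definition msubst_monom :: "(nat \<Rightarrow> 'a::comm_ring_1 mpoly) \<Rightarrow> (nat \<Rightarrow>\<^sub>0 nat) \<Rightarrow> 'a mpoly" where
  "msubst_monom v m = (\<Prod>k\<in>Poly_Mapping.keys m. v k ^ Poly_Mapping.lookup m k)"

definition msubst :: "(nat \<Rightarrow> 'a::comm_ring_1 mpoly) \<Rightarrow> 'a mpoly \<Rightarrow> 'a mpoly" where
  "msubst v p =
     (\<Sum>m\<in>Poly_Mapping.keys p. mconst (Poly_Mapping.lookup p m) * msubst_monom v m)"

lemma mconst_0 [simp]: "mconst 0 = 0"
  and mconst_1 [simp]: "mconst 1 = 1"
  and mconst_add: "mconst (a + b) = mconst a + mconst b"
  and mconst_mult: "mconst (a * b) = mconst a * mconst b"
  for a b :: "'a::comm_ring_1"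
  by (simp_all add: mconst_def single_add mult_single)

lemma msubst_monom_superset:
  assumes "finite A" "Poly_Mapping.keys m \<subseteq> A"
  shows "msubst_monom v m = (\<Prod>k\<in>A. v k ^ Poly_Mapping.lookup m k)"
  unfolding msubst_monom_def using assms
  by (intro prod.mono_neutral_left) (auto simp: in_keys_iff)

lemma msubst_superset:
  assumes "finite A" "Poly_Mapping.keys p \<subseteq> A"
  shows "msubst v p = (\<Sum>m\<in>A. mconst (Poly_Mapping.lookup p m) * msubst_monom v m)"
  unfolding msubst_def using assms
  by (intro sum.mono_neutral_left) (auto simp: in_keys_iff)

lemma msubst_monom_add: "msubst_monom v (m + n) = msubst_monom v m * msubst_monom v n"
proof -
  let ?A = "Poly_Mapping.keys m \<union> Poly_Mapping.keys n"
  have "msubst_monom v (m + n) = (\<Prod>k\<in>?A. v k ^ Poly_Mapping.lookup (m + n) k)"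
    using Poly_Mapping.keys_add[of m n] by (intro msubst_monom_superset) auto
  also have "\<dots> = (\<Prod>k\<in>?A. v k ^ Poly_Mapping.lookup m k) * (\<Prod>k\<in>?A. v k ^ Poly_Mapping.lookup n k)"
    by (simp add: lookup_add power_add prod.distrib)
  also have "\<dots> = msubst_monom v m * msubst_monom v n"
    by (simp add: msubst_monom_superset[of ?A])
  finally show ?thesis .
qed

lemma msubst_0 [simp]: "msubst v 0 = 0"
  by (simp add: msubst_def)

lemma msubst_add: "msubst v (p + r) = msubst v p + msubst v r"
proof -
  let ?A = "Poly_Mapping.keys p \<union> Poly_Mapping.keys r"
  have "msubst v (p + r) = (\<Sum>m\<in>?A. mconst (Poly_Mapping.lookup (p + r) m) * msubst_monom v m)"
    using Poly_Mapping.keys_add[of p r] by (intro msubst_superset) auto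
  also have "\<dots> = msubst v p + msubst v r"
    by (simp add: msubst_superset[of ?A] lookup_add mconst_add sum.distrib algebra_simps)
  finally show ?thesis .
qed

lemma msubst_single: "msubst v (Poly_Mapping.single m c) = mconst c * msubst_monom v m"
  by (cases "c = 0") (simp_all add: msubst_def)

lemma msubst_mconst [simp]: "msubst v (mconst c) = mconst c"
  by (simp add: mconst_def[of c] msubst_single) (simp add: msubst_monom_def mconst_def)

lemma msubst_1 [simp]: "msubst v 1 = 1"
  using msubst_mconst[of v 1] by simp

lemma msubst_mvar [simp]: "msubst v (mvar k) = v k"
  by (simp add: mvar_def msubst_single) (simp add: msubst_monom_def)

lemma mpoly_single_induct [case_names single add]:
  fixes p :: "'b \<Rightarrow>\<^sub>0 'a::comm_monoid_add"
  assumes "\<And>m c. P (Poly_Mapping.single m c)" "\<And>p r. P p \<Longrightarrow> P r \<Longrightarrow> P (p + r)"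
  shows "P p"
proof (induction p rule: Poly_Mapping.update_induct)
  case const
  show ?case using assms(1)[of undefined 0] by simp
next
  case (update f a b)
  have "Poly_Mapping.update a b f = Poly_Mapping.single a b + f"
    using update by (intro poly_mapping_eqI)
      (auto simp: lookup_update lookup_add lookup_single in_keys_iff when_def)
  then show ?case using assms update by simp
qed

lemma msubst_mult: "msubst v (p * r) = msubst v p * msubst v r"
proof (induction p rule: mpoly_single_induct)
  case (single m c)
  show ?case
  proof (induction r rule: mpoly_single_induct)
    case (single n d)
    show ?case
      by (simp add: mult_single msubst_single msubst_monom_add mconst_mult mult_ac)
  qed (simp add: msubst_add algebra_simps)
qed (simp add: msubst_add algebra_simps)

lemma msubst_power: "msubst v (p ^ k) = msubst v p ^ k"
  by (induction k) (simp_all add: msubst_mult)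

lemma msubst_msubst: "msubst w (msubst v p) = msubst (\<lambda>k. msubst w (v k)) p"
proof (induction p rule: mpoly_single_induct)
  case (single m c)
  have "msubst w (prod f A) = (\<Prod>a\<in>A. msubst w (f a))" for f :: "nat \<Rightarrow> 'a mpoly" and A
    by (induction A rule: infinite_finite_induct) (simp_all add: msubst_mult)
  then show ?case
    by (simp add: msubst_single msubst_mult msubst_monom_def msubst_power)
qed (simp add: msubst_add)

lemma msubst_mvar_id: "msubst mvar p = p"
proof (induction p rule: mpoly_single_induct)
  case (single m c)
  have power: "mvar k ^ e = Poly_Mapping.single (Poly_Mapping.single k e) (1::'a)" for k e
    by (induction e) (simp_all add: mvar_def mult_single flip: single_add)
  have "msubst_monom mvar m = Poly_Mapping.single m (1::'a)"
  proof (induction m rule: mpoly_single_induct)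
    case (single k e)
    show ?case by (cases "e = 0") (simp_all add: msubst_monom_def power)
  qed (simp add: msubst_monom_add mult_single)
  then show ?case
    by (simp add: msubst_single mconst_def mult_single)
qed (simp add: msubst_add)

section \<open>Rational functions\<close>

text \<open>\<open>rsubst v f\<close> substitutes \<open>v k\<close> for the variable \<open>k\<close> in \<open>f\<close>. The value is
  independent of the chosen fraction, and is only meaningful if some denominator of \<open>f\<close> does not
  become zero; see \<open>rsubst_Fract\<close>. All substitutions below are invertible, so this always
  holds for them.\<close>

definition rsubst ::
    "(nat \<Rightarrow> 'a::idom mpoly) \<Rightarrow> 'a mpoly fract \<Rightarrow> 'a mpoly fract" where
  "rsubst v f = (THE g. \<exists>a b. f = Fract a b \<and> msubst v b \<noteq> 0 \<and>
                              g = Fract (msubst v a) (msubst v b))"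

lemma rsubst_Fract:
  assumes "msubst v b \<noteq> 0"
  shows "rsubst v (Fract a b) = Fract (msubst v a) (msubst v b)"
  unfolding rsubst_def
proof (rule the_equality)
  fix g assume "\<exists>a' b'. Fract a b = Fract a' b' \<and> msubst v b' \<noteq> 0 \<and>
                              g = Fract (msubst v a') (msubst v b')"
  then obtain a' b' where *: "Fract a b = Fract a' b'" "msubst v b' \<noteq> 0"
    and g: "g = Fract (msubst v a') (msubst v b')" by blast
  have "b \<noteq> 0" "b' \<noteq> 0" using assms * by auto
  then have "a * b' = a' * b" using * by (simp add: eq_fract)
  then have "msubst v (a * b') = msubst v (a' * b)" by simp
  then show "g = Fract (msubst v a) (msubst v b)"
    using g assms * by (simp add: msubst_mult eq_fract)
qed (use assms in blast)

definition rational_functions :: "nat \<Rightarrow> 'a::idom mpoly fract set" where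
  "rational_functions N =
     {Fract a b | a b. b \<noteq> 0 \<and> mvars a \<subseteq> {1..N} \<and> mvars b \<subseteq> {1..N}}"

definition symmetric_rational_functions :: "nat \<Rightarrow> 'a::idom mpoly fract set" where
  "symmetric_rational_functions N =
     {f \<in> rational_functions N. \<forall>\<sigma>. \<sigma> permutes {1..N} \<longrightarrow> rsubst (\<lambda>k. mvar (\<sigma> k)) f = f}"

lemma msubst_permutes_nonzero:
  assumes "\<sigma> permutes A" "b \<noteq> 0"
  shows "msubst (\<lambda>k. mvar (\<sigma> k)) b \<noteq> 0"
proof
  assume "msubst (\<lambda>k. mvar (\<sigma> k)) b = 0"
  then have "msubst (\<lambda>k. mvar (inv \<sigma> k)) (msubst (\<lambda>k. mvar (\<sigma> k)) b) = 0" by simp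
  then show False
    using assms by (simp add: msubst_msubst permutes_inverses msubst_mvar_id)
qed

section \<open>Difference operators over C(q,t)\<close>

text \<open>The fraction field of C[q][t]: \<open>q\<close> is the inner and \<open>t\<close> the outer variable.\<close>

type_synonym qt_field = "complex poly poly fract"
type_synonym ratfun = "qt_field mpoly fract"

definition qt_q :: qt_field where "qt_q = Fract [:[:0, 1:]:] 1"
definition qt_t :: qt_field where "qt_t = Fract [:0, 1:] 1"

definition rconst :: "qt_field \<Rightarrow> ratfun" where "rconst c = Fract (mconst c) 1"

abbreviation t :: ratfun where "t \<equiv> rconst qt_t"

definition X :: "nat \<Rightarrow> ratfun" where "X k = Fract (mvar k) 1"

definition \<Gamma> :: "nat \<Rightarrow> ratfun \<Rightarrow> ratfun" where
  "\<Gamma> i = rsubst (mvar(i := mconst qt_q * mvar i))"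

definition macdonald :: "nat \<Rightarrow> int \<Rightarrow> ratfun \<Rightarrow> ratfun" where
  "macdonald N n f =
     (\<Sum>i=1..N. X i powi n * (\<Prod>j\<in>{1..N} - {i}. (t * X i - X j) / (X i - X j)) * \<Gamma> i f)"

text \<open>The limit of \<open>t ^ -(N - 1)\<close> times the previous operator as \<open>t\<close> tends to infinity;
  \<open>macdonald_inf_is_limit\<close> below justifies the formula.\<close>

definition macdonald_inf :: "nat \<Rightarrow> int \<Rightarrow> ratfun \<Rightarrow> ratfun" where
  "macdonald_inf N n f =
     (\<Sum>i=1..N. X i powi n * (\<Prod>j\<in>{1..N} - {i}. X i / (X i - X j)) * \<Gamma> i f)"

definition elem_sym :: "nat \<Rightarrow> nat \<Rightarrow> ratfun" where
  "elem_sym N j = (\<Sum>S | S \<subseteq> {1..N} \<and> card S = j. \<Prod>k\<in>S. X k)"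

lemma qt_q_nonzero: "qt_q \<noteq> 0"
  by (simp add: qt_q_def Zero_fract_def eq_fract)

lemma t_nonzero: "t \<noteq> 0"
proof -
  have "qt_t \<noteq> 0" by (simp add: qt_t_def Zero_fract_def eq_fract)
  then have "mconst qt_t \<noteq> 0"
    by (metis lookup_single_eq lookup_zero mconst_def)
  then show ?thesis by (simp add: rconst_def Zero_fract_def eq_fract)
qed

lemma msubst_shift_nonzero:
  assumes "b \<noteq> 0"
  shows "msubst (mvar(i := mconst qt_q * mvar i)) b \<noteq> 0"
proof
  let ?v = "mvar(i := mconst qt_q * mvar i)" and ?w = "mvar(i := mconst (inverse qt_q) * mvar i)"
  assume "msubst ?v b = 0"
  then have 0: "msubst (\<lambda>k. msubst ?w (?v k)) b = 0"
    by (simp only: msubst_msubst[symmetric] msubst_0)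
  have "mconst qt_q * mconst (inverse qt_q) = 1"
    using qt_q_nonzero by (simp flip: mconst_mult)
  then have "(\<lambda>k. msubst ?w (?v k)) = mvar"
    by (auto simp: fun_eq_iff msubst_mult mult.assoc[symmetric])
  then show False using 0 assms by (simp add: msubst_mvar_id)
qed

lemma \<Gamma>_Fract:
  assumes "b \<noteq> 0"
  shows "\<Gamma> i (Fract a b) = Fract (msubst (mvar(i := mconst qt_q * mvar i)) a)
                                (msubst (mvar(i := mconst qt_q * mvar i)) b)"
  unfolding \<Gamma>_def by (rule rsubst_Fract[OF msubst_shift_nonzero[OF assms]])

lemma \<Gamma>_X: "\<Gamma> i (X k) = (if k = i then rconst qt_q * X k else X k)"
  by (simp add: X_def \<Gamma>_Fract rconst_def)

lemma \<Gamma>_rconst: "\<Gamma> i (rconst c) = rconst c"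
  by (simp add: rconst_def \<Gamma>_Fract)

lemma \<Gamma>_add: "\<Gamma> i (f + g) = \<Gamma> i f + \<Gamma> i g"
  by (cases f, cases g) (simp add: \<Gamma>_Fract msubst_add msubst_mult msubst_shift_nonzero)

lemma \<Gamma>_mult: "\<Gamma> i (f * g) = \<Gamma> i f * \<Gamma> i g"
  by (cases f, cases g) (simp add: \<Gamma>_Fract msubst_mult)

text \<open>Up to the common factor \<open>X i powi n\<close>, the coefficient of \<open>\<Gamma> i\<close> in \<open>t ^ -(N - 1)\<close> times the Macdonald operator is a
  polynomial in \<open>1 / t\<close> with \<open>t\<close>-free coefficients; its value at \<open>1 / t = 0\<close> is the
  coefficient in \<open>macdonald_inf\<close>.\<close>

lemma macdonald_inf_is_limit:
  fixes N i :: nat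
  defines "P \<equiv> \<Prod>j\<in>{1..N} - {i}. [:X i / (X i - X j), - X j / (X i - X j):]"
  assumes "i \<in> {1..N}"
  shows "poly P (inverse t) =
           inverse t ^ (N - 1) * (\<Prod>j\<in>{1..N} - {i}. (t * X i - X j) / (X i - X j))"
    and "poly P 0 = (\<Prod>j\<in>{1..N} - {i}. X i / (X i - X j))"
proof -
  have "inverse t ^ (N - 1) = (\<Prod>j\<in>{1..N} - {i}. inverse t)"
    using assms by simp
  moreover have "X i / (X i - X j) + inverse t * (- X j / (X i - X j)) =
      inverse t * ((t * X i - X j) / (X i - X j))" for j
    using t_nonzero by (simp add: algebra_simps diff_divide_distrib)
  ultimately show "poly P (inverse t) =
           inverse t ^ (N - 1) * (\<Prod>j\<in>{1..N} - {i}. (t * X i - X j) / (X i - X j))"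
    unfolding P_def poly_prod by (simp only: poly_pCons poly_0 mult_zero_right add_0_right prod.distrib)
  show "poly P 0 = (\<Prod>j\<in>{1..N} - {i}. X i / (X i - X j))"
    by (simp add: P_def poly_prod)
qed

end

theory Submission
  imports Defs
begin

text \<open>For each \<open>i\<close> compare the coefficients of \<open>\<Gamma> i\<close>. Since
  \<open>X i powi (n - j) = X i powi n * inverse (X i) ^ j\<close>, the sum over \<open>j\<close> is the generating
  function of the elementary symmetric functions at \<open>- 1 / (t * X i)\<close>. It factors as the product over
  all \<open>k\<close> of \<open>1 - X k / (t * X i)\<close>, and its factor \<open>k = i\<close> cancels the \<open>t - 1\<close> in the
  denominator of the prefactor.\<close>

lemma X_nonzero: "X k \<noteq> 0"
proof -
  have "mvar k \<noteq> (0 :: qt_field mpoly)"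
    by (metis lookup_single_eq lookup_zero mvar_def zero_neq_one)
  then show ?thesis by (simp add: X_def Zero_fract_def eq_fract)
qed

lemma t_neq_1: "t \<noteq> 1"
proof -
  have "qt_t \<noteq> 1" by (simp add: qt_t_def One_fract_def eq_fract one_pCons)
  then have "mconst qt_t \<noteq> 1"
    by (metis lookup_single_eq mconst_1 mconst_def)
  then show ?thesis
    unfolding rconst_def One_fract_def[where 'a = "qt_field mpoly"] by (simp add: eq_fract)
qed

text \<open>Expanding the product means choosing \<open>c * X k\<close> for \<open>k\<close> in a
  subset \<open>S\<close> and \<open>1\<close> elsewhere; the subsets of cardinality
  \<open>j\<close> together contribute the term with \<open>c ^ j\<close>.\<close>

lemma sum_power_elem_sym:
  "(\<Sum>j=0..N. c ^ j * elem_sym N j) = (\<Prod>k\<in>{1..N}. 1 + c * X k)"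
proof -
  have "(\<Sum>j=0..N. c ^ j * elem_sym N j) =
      (\<Sum>j=0..N. \<Sum>S | S \<in> Pow {1..N} \<and> card S = j. \<Prod>k\<in>S. c * X k)"
    by (intro sum.cong) (simp_all add: elem_sym_def sum_distrib_left prod.distrib)
  also have "\<dots> = (\<Sum>S\<in>Pow {1..N}. \<Prod>k\<in>S. c * X k)"
    \<comment> \<open>Every subset of \<open>{1..N}\<close> has cardinality at most
      \<open>N\<close>, so the range \<open>0..N\<close> misses none.\<close>
    by (rule sum.group) (auto dest: card_mono[rotated])
  also have "\<dots> = (\<Prod>k\<in>{1..N}. 1 + c * X k)"
    using prod_add[of "{1..N}" "\<lambda>k. c * X k" "\<lambda>_. 1"] by (simp add: add.commute)
  finally show ?thesis .
qed

text \<open>The generating function at \<open>c = - inverse t * inverse (X i)\<close> has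
  \<open>N\<close> factors, and each absorbs one \<open>t\<close> from \<open>t ^ N\<close>. The
  factor at \<open>k = i\<close> then becomes \<open>t - 1\<close>.\<close>

lemma power_t_times_sum_elem_sym:
  assumes "i \<in> {1..N}"
  shows "t ^ N * (\<Sum>j=0..N. (- inverse t) ^ j * elem_sym N j * inverse (X i) ^ j) =
    (t - 1) * (\<Prod>k\<in>{1..N} - {i}. (t * X i - X k) / X i)"
proof -
  have "t ^ N * (\<Sum>j=0..N. (- inverse t) ^ j * elem_sym N j * inverse (X i) ^ j) =
      t ^ N * (\<Sum>j=0..N. (- inverse t * inverse (X i)) ^ j * elem_sym N j)"
    by (simp only: power_mult_distrib mult_ac)
  also have "\<dots> = (\<Prod>k\<in>{1..N}. t) * (\<Prod>k\<in>{1..N}. 1 + - inverse t * inverse (X i) * X k)"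
    by (simp only: sum_power_elem_sym) simp
  also have "\<dots> = (\<Prod>k\<in>{1..N}. t * (1 + - inverse t * inverse (X i) * X k))"
    by (simp only: prod.distrib)
  also have "\<dots> = (\<Prod>k\<in>{1..N}. (t * X i - X k) / X i)"
  proof (rule prod.cong[OF refl])
    fix k
    have "s * (1 + - inverse s * inverse x * y) = (s * x - y) / x"
      if "s \<noteq> 0" "x \<noteq> 0" for s x y :: ratfun
      using that by (simp add: field_simps)
    then show "t * (1 + - inverse t * inverse (X i) * X k) = (t * X i - X k) / X i"
      using t_nonzero X_nonzero by blast
  qed
  also have "\<dots> = (t * X i - X i) / X i * (\<Prod>k\<in>{1..N} - {i}. (t * X i - X k) / X i)"
    using assms by (simp add: prod.remove)
  also have "(t * X i - X i) / X i = t - 1"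
    by (simp add: field_simps X_nonzero)
  finally show ?thesis .
qed

theorem theorem7p1:
  fixes N :: nat and n :: int and f :: ratfun
  assumes "N \<ge> 1"
    and "f \<in> symmetric_rational_functions N"
  shows "macdonald N n f =
    t ^ N / (t - 1) *
      (\<Sum>j=0..N. (- inverse t) ^ j * elem_sym N j * macdonald_inf N (n - int j) f)"
proof -
  \<comment> \<open>\<open>E i j\<close> takes over the \<open>inverse (X i) ^ j\<close> split off
    from \<open>X i powi (n - int j)\<close>, so that \<open>X i powi n * R i\<close> no longer
    depends on \<open>j\<close>.\<close>
  define E where "E i j = (- inverse t) ^ j * elem_sym N j * inverse (X i) ^ j" for i j
  define R where "R i = (\<Prod>j\<in>{1..N} - {i}. X i / (X i - X j))" for i
  have "X i powi n * (\<Prod>j\<in>{1..N} - {i}. (t * X i - X j) / (X i - X j)) * \<Gamma> i f =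
      t ^ N / (t - 1) * (\<Sum>j=0..N. E i j) * (X i powi n * R i * \<Gamma> i f)"
    if i: "i \<in> {1..N}" for i
  proof -
    have "t ^ N / (t - 1) * (\<Sum>j=0..N. E i j) = (\<Prod>k\<in>{1..N} - {i}. (t * X i - X k) / X i)"
      using power_t_times_sum_elem_sym[OF i] t_neq_1 by (simp add: E_def)
    \<comment> \<open>The numerators \<open>X i\<close> of \<open>R i\<close> cancel the
      denominators factor by factor, leaving the Macdonald coefficient.\<close>
    moreover have "(\<Prod>k\<in>{1..N} - {i}. (t * X i - X k) / X i) * R i =
        (\<Prod>k\<in>{1..N} - {i}. (t * X i - X k) / (X i - X k))"
      by (simp add: R_def X_nonzero flip: prod.distrib)
    ultimately have "(\<Prod>k\<in>{1..N} - {i}. (t * X i - X k) / (X i - X k)) =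
        t ^ N / (t - 1) * (\<Sum>j=0..N. E i j) * R i"
      by simp
    then show ?thesis by (simp only: mult_ac)
  qed
  then have "macdonald N n f =
      (\<Sum>i=1..N. t ^ N / (t - 1) * (\<Sum>j=0..N. E i j) * (X i powi n * R i * \<Gamma> i f))"
    unfolding macdonald_def by (intro sum.cong) simp_all
  also have "\<dots> = t ^ N / (t - 1) *
      (\<Sum>i=1..N. \<Sum>j=0..N. E i j * (X i powi n * R i * \<Gamma> i f))"
    by (simp only: sum_distrib_left sum_distrib_right mult.assoc)
  also have "(\<Sum>i=1..N. \<Sum>j=0..N. E i j * (X i powi n * R i * \<Gamma> i f)) =
      (\<Sum>j=0..N. \<Sum>i=1..N. E i j * (X i powi n * R i * \<Gamma> i f))"
    by (rule sum.swap)
  also have "\<dots> =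
      (\<Sum>j=0..N. (- inverse t) ^ j * elem_sym N j * macdonald_inf N (n - int j) f)"
  proof (rule sum.cong[OF refl])
    fix j
    \<comment> \<open>The exponent may be negative; the splitting relies on \<open>X i\<close> being
      nonzero.\<close>
    have "X i powi (n - int j) = inverse (X i) ^ j * X i powi n" for i
      by (simp add: power_int_diff X_nonzero power_inverse divide_inverse mult.commute)
    then show "(\<Sum>i=1..N. E i j * (X i powi n * R i * \<Gamma> i f)) =
        (- inverse t) ^ j * elem_sym N j * macdonald_inf N (n - int j) f"
      by (simp only: E_def R_def macdonald_inf_def sum_distrib_left mult.assoc)
  qed
  finally show ?thesis .
qed

end
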